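(* For every complex number $a$ with $4a+\tfrac92\notin\{0,-1,-2,\dots\}$, $$F_1\left(\tfrac12;\,-a,\,3a+\tfrac52;\,4a+\tfrac92;\,\tfrac{27}{32},\tfrac56\right)=\frac{1}{5\sqrt3\;2^{6a+3/2}}\,\frac{\pi\,\Gamma(4a+9/2)}{\Gamma(a+3/2)^2\,\Gamma(2a+5/2)}.$$
   Context: Appell's hypergeometric series is $F_1(\alpha;\beta_1,\beta_2;\gamma;x,y)=\sum_{m,n\ge0}\frac{(\alpha,m+n)(\beta_1,m)(\beta_2,n)}{(\gamma,m+n)(1,m)(1,n)}x^my^n$ for $\gamma\notin\{0,-1,-2,\dots\}$, absolutely convergent for $|x|<1$, $|y|<1$, where $(\alpha,n)=\alpha(\alpha+1)\cdots(\alpha+n-1)$, $(\alpha,0)=1$. For real $r>0$, $r^{a}=e^{a\log r}$ with real $\log r$. $1/\Gamma$ is the entire function (zero at the poles of $\Gamma$). *)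

theory Defs
  imports "HOL-Analysis.Analysis"
begin

text \<open>Appell's double series, summed unconditionally over all pairs of indices. It is meaningful
  for a third parameter \<open>c\<close> that is not a nonpositive integer and for arguments of norm less
  than 1, where the series converges absolutely.\<close>

definition appell_F1 ::
  "complex \<Rightarrow> complex \<Rightarrow> complex \<Rightarrow> complex \<Rightarrow> complex \<Rightarrow> complex \<Rightarrow> complex" where
  "appell_F1 a b1 b2 c x y =
     (\<Sum>\<^sub>\<infinity>(m, n)\<in>UNIV.
        pochhammer a (m + n) * pochhammer b1 m * pochhammer b2 n /
        (pochhammer c (m + n) * pochhammer 1 m * pochhammer 1 n) * x ^ m * y ^ n)"

end

theory Submission
  imports Defs
begin

text \<open>Write \<open>F(a)\<close> for the left-hand side. Collecting the terms with \<open>m + n = k\<close> turns \<open>F(a)\<close> into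
  \<open>\<Sum>k. (1/2, k) / (4a + 9/2, k) [t^k] (1 - 27t/32)^a (1 - 5t/6)^(-3a - 5/2)\<close>. At these arguments the contiguity
  relation between \<open>F(a)\<close> and \<open>F(a + 1)\<close> has order one, as a telescoping certificate shows. Iterating it
  gives \<open>F(a) = R\<^sub>n F(a + n)\<close> with \<open>R\<^sub>n\<close> a quotient of Pochhammer symbols. By dominated convergence
  \<open>F(a + n)\<close> tends to \<open>(75/128)^(-1/2)\<close>, while \<open>R\<^sub>n\<close> tends to a quotient of Gamma values that the
  duplication formula simplifies.\<close>

section \<open>The double series as a single series\<close>

lemma pochhammer_nonneg_weak:
  fixes x :: "'a :: linordered_semidom"
  shows "0 \<le> x \<Longrightarrow> 0 \<le> pochhammer x n"
  by (induction n) (auto simp: pochhammer_Suc)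

lemma norm_pochhammer_le:
  fixes p :: "'a :: real_normed_field"
  assumes "norm p \<le> P"
  shows "norm (pochhammer p k) \<le> pochhammer P k"
proof (induction k)
  case (Suc k)
  have "norm (p + of_nat k) \<le> P + of_nat k"
    using norm_triangle_ineq[of p "of_nat k"] assms by simp
  moreover have "0 \<le> P" using assms norm_ge_zero[of p] by linarith
  ultimately show ?case
    using Suc by (auto simp: pochhammer_Suc norm_mult intro!: mult_mono pochhammer_nonneg_weak)
qed auto

text \<open>The expansion of \<open>(1 - x t)^(-p)\<close>; the pair below is \<open>(1 - x t)^(-p) (1 - y t)^(-q)\<close>.\<close>

definition neg_binomial_fps :: "complex \<Rightarrow> complex \<Rightarrow> complex fps" where
  "neg_binomial_fps p x = Abs_fps (\<lambda>n. pochhammer p n / fact n * x ^ n)"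

text \<open>Pascal's rule for rising factorials. It lets the generating functions for
  \<open>a\<close> and \<open>a + 1\<close> be written as polynomial multiples of one common
  series.\<close>

lemma neg_binomial_fps_shift:
  "(1 - fps_const x * fps_X) * neg_binomial_fps (p + 1) x = neg_binomial_fps p x"
proof (rule fps_ext)
  fix n
  show "fps_nth ((1 - fps_const x * fps_X) * neg_binomial_fps (p + 1) x) n =
          fps_nth (neg_binomial_fps p x) n"
  proof (cases n)
    case (Suc m)
    define P F M where "P = pochhammer (p + 1) m" and "F = (fact m :: complex)"
      and "M = (of_nat m :: complex)"
    have nz: "1 + M \<noteq> 0" unfolding M_def by (metis of_nat_Suc of_nat_neq_0)
    have "F \<noteq> 0" by (simp add: F_def)
    have "pochhammer (p + 1) (Suc m) / fact (Suc m) * x ^ Suc m - x * (P / F * x ^ m) =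
            (P * (p + 1 + M) / ((1 + M) * F) - P / F) * x ^ Suc m"
      by (simp add: P_def F_def M_def pochhammer_Suc algebra_simps)
    also have "P * (p + 1 + M) / ((1 + M) * F) - P / F = p * P / ((1 + M) * F)"
      using nz \<open>F \<noteq> 0\<close> by (simp add: divide_simps) (simp add: algebra_simps)
    also have "\<dots> = pochhammer p (Suc m) / fact (Suc m)"
      by (simp add: P_def F_def M_def pochhammer_rec)
    finally show ?thesis
      unfolding Suc by (simp add: neg_binomial_fps_def P_def F_def left_diff_distrib mult.assoc)
  qed (simp add: neg_binomial_fps_def algebra_simps)
qed

text \<open>The differential equation of \<open>(1 - x t)^(-p)\<close>, checked through the two-term
  recurrence of its coefficients.\<close>

lemma fps_deriv_neg_binomial_fps:
  "(1 - fps_const x * fps_X) * fps_deriv (neg_binomial_fps p x) =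
     fps_const (p * x) * neg_binomial_fps p x"
proof (rule fps_ext)
  fix n
  define d where "d = fps_nth (neg_binomial_fps p x)"
  have d: "of_nat (Suc m) * d (Suc m) = (p + of_nat m) * x * d m" for m
  proof -
    have "(of_nat (Suc m) :: complex) \<noteq> 0" by (rule of_nat_neq_0)
    thus ?thesis
      by (simp add: d_def neg_binomial_fps_def pochhammer_Suc del: of_nat_Suc)
  qed
  show "fps_nth ((1 - fps_const x * fps_X) * fps_deriv (neg_binomial_fps p x)) n =
          fps_nth (fps_const (p * x) * neg_binomial_fps p x) n"
  proof (cases n)
    case 0
    thus ?thesis using d[of 0] by (simp add: left_diff_distrib mult.assoc flip: d_def)
  next
    case (Suc m)
    have "fps_nth ((1 - fps_const x * fps_X) * fps_deriv (neg_binomial_fps p x)) n =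
            of_nat (Suc n) * d (Suc n) - x * (of_nat n * d n)"
      using Suc by (simp add: left_diff_distrib mult.assoc flip: d_def)
    also have "\<dots> = p * x * d n" unfolding d by (simp add: algebra_simps)
    finally show ?thesis by (simp add: d_def)
  qed
qed

definition binomial_pair_fps :: "complex \<Rightarrow> complex \<Rightarrow> complex \<Rightarrow> complex \<Rightarrow> complex fps" where
  "binomial_pair_fps p q x y = neg_binomial_fps p x * neg_binomial_fps q y"

text \<open>The pair \<open>H\<close> solves
  \<open>(1 - x t) (1 - y t) H' = (p x (1 - y t) + q y (1 - x t)) H\<close>; comparing coefficients
  of \<open>t^k\<close> gives three terms.\<close>

lemma binomial_pair_fps_recurrence:
  fixes p q x y :: complex
  defines "v \<equiv> fps_nth (binomial_pair_fps p q x y)"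
  shows "(of_nat k + 1) * v (Suc k) =
           ((x + y) * of_nat k + p * x + q * y) * v k -
           (if k = 0 then 0 else x * y * (of_nat k - 1 + p + q) * v (k - 1))"
proof -
  define A B where "A = neg_binomial_fps p x" and "B = neg_binomial_fps q y"
  define H where "H = A * B"
  define X a b where "X = (fps_X :: complex fps)" and "a = fps_const x" and "b = fps_const y"
  define P Q where "P = fps_const p" and "Q = fps_const q"
  have h: "binomial_pair_fps p q x y = A * B" by (simp add: binomial_pair_fps_def A_def B_def)
  have A: "(1 - a * X) * fps_deriv A = P * a * A"
   and B: "(1 - b * X) * fps_deriv B = Q * b * B"
    by (simp_all add: A_def B_def X_def a_def b_def P_def Q_def fps_deriv_neg_binomial_fps)
  have "(1 - a * X) * (1 - b * X) * fps_deriv (A * B) =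
          (1 - b * X) * B * ((1 - a * X) * fps_deriv A) +
          (1 - a * X) * A * ((1 - b * X) * fps_deriv B)"
    by (simp add: algebra_simps)
  also have "\<dots> = (P * a * (1 - b * X) + Q * b * (1 - a * X)) * (A * B)"
    unfolding A B by (simp add: algebra_simps)
  finally have "fps_deriv (A * B) - (a + b) * (X * fps_deriv (A * B)) +
                  a * b * (X * (X * fps_deriv (A * B))) =
                (P * a + Q * b) * (A * B) - a * b * (P + Q) * (X * (A * B))"
    by (simp add: algebra_simps)
  hence "fps_deriv (A * B) - fps_const (x + y) * (X * fps_deriv (A * B)) +
                  fps_const (x * y) * (X * (X * fps_deriv (A * B))) =
                fps_const (p * x + q * y) * (A * B) - fps_const (x * y * (p + q)) * (X * (A * B))"
    by (simp add: a_def b_def P_def Q_def)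
  hence "fps_deriv H - fps_const (x + y) * (X * fps_deriv H) + fps_const (x * y) * (X * (X * fps_deriv H)) =
           fps_const (p * x + q * y) * H - fps_const (x * y * (p + q)) * (X * H)"
    unfolding H_def .
  \<comment> \<open>One and two factors \<open>X\<close> shift the index, so \<open>k = 0\<close>
    and \<open>k = 1\<close> are separated from the generic case.\<close>
  from arg_cong[OF this, of "\<lambda>f. fps_nth f k"] show ?thesis
    unfolding v_def h H_def[symmetric] X_def
    by (cases k; cases "k - 1") (simp_all add: algebra_simps)
qed

text \<open>Replacing everything by its bound leaves a Vandermonde sum, the coefficient of
  \<open>(1 - \<rho> t)^(-P - Q)\<close>. The norms stay inside the sum because absolute convergence
  over pairs of indices is wanted.\<close>

lemma norm_binomial_pair_coeff_le:
  fixes p q x y :: complex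
  assumes "norm p \<le> P" "norm q \<le> Q" "norm x \<le> \<rho>" "norm y \<le> \<rho>"
  shows "(\<Sum>i\<le>k. norm (pochhammer p i / fact i * x ^ i *
                  (pochhammer q (k - i) / fact (k - i) * y ^ (k - i))))
           \<le> pochhammer (P + Q) k / fact k * \<rho> ^ k"
proof -
  have nonneg: "0 \<le> P" "0 \<le> Q" "0 \<le> \<rho>"
    using assms norm_ge_zero[of p] norm_ge_zero[of q] norm_ge_zero[of x] by linarith+
  have "(\<Sum>i\<le>k. norm (pochhammer p i / fact i * x ^ i *
                  (pochhammer q (k - i) / fact (k - i) * y ^ (k - i))))
        \<le> (\<Sum>i\<le>k. pochhammer P i / fact i * \<rho> ^ i * (pochhammer Q (k - i) / fact (k - i) * \<rho> ^ (k - i)))"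
    using assms nonneg
    by (intro sum_mono, unfold norm_mult norm_divide norm_power norm_fact)
       (intro mult_mono divide_right_mono norm_pochhammer_le power_mono mult_nonneg_nonneg;
        simp add: pochhammer_nonneg_weak)
  also have "\<dots> = (\<Sum>i\<le>k. of_nat (k choose i) * pochhammer P i * pochhammer Q (k - i)) / fact k * \<rho> ^ k"
    unfolding sum_divide_distrib sum_distrib_right
    by (intro sum.cong refl) (simp add: binomial_fact field_simps flip: power_add)
  also have "\<dots> = pochhammer (P + Q) k / fact k * \<rho> ^ k"
    by (simp add: pochhammer_binomial_sum)
  finally show ?thesis .
qed

lemma nth_binomial_pair_fps:
  "fps_nth (binomial_pair_fps p q x y) k =
     (\<Sum>i\<le>k. pochhammer p i / fact i * x ^ i * (pochhammer q (k - i) / fact (k - i) * y ^ (k - i)))"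
  by (simp add: binomial_pair_fps_def fps_mult_nth neg_binomial_fps_def atLeast0AtMost)

section \<open>Absolute convergence and grouping by total degree\<close>

lemma summable_ratio_limit:
  fixes f :: "nat \<Rightarrow> real"
  assumes "\<And>n. f n > 0" "(\<lambda>n. f (Suc n) / f n) \<longlonglongrightarrow> r" "r < 1"
  shows "summable f"
proof -
  obtain s where s: "r < s" "s < 1" using dense[OF assms(3)] by blast
  from order_tendstoD(2)[OF assms(2) s(1)] obtain N where
    N: "\<And>n. n \<ge> N \<Longrightarrow> f (Suc n) / f n < s" by (auto simp: eventually_at_top_linorder)
  show ?thesis
    using N assms(1) s(2)
    by (intro summable_ratio_test[of s N])
       (auto simp: pos_divide_less_eq less_imp_le abs_of_pos)
qed

lemma tendsto_linear_ratio:
  fixes e :: "'a :: real_normed_field"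
  shows "(\<lambda>n. (e + of_nat n) / (of_nat n + 1)) \<longlonglongrightarrow> 1"
proof -
  have nz: "(1 + of_nat n :: 'a) \<noteq> 0" for n by (metis of_nat_Suc of_nat_neq_0)
  have "(\<lambda>n. 1 + (e - 1) * inverse (of_nat (Suc n))) \<longlonglongrightarrow> 1 + (e - 1) * 0"
    using LIMSEQ_Suc[OF lim_inverse_n[where 'a='a]] by (intro tendsto_intros)
  moreover have "1 + (e - 1) * inverse (of_nat (Suc n)) = (e + of_nat n) / (of_nat n + 1)" for n
    using nz[of n] by (simp add: field_simps)
  ultimately show ?thesis by simp
qed

text \<open>The quotient of consecutive terms tends to \<rho>. The factor
  \<open>real (Suc k) ^ j\<close> leaves this limit alone and makes room for polynomial
  multipliers.\<close>

lemma summable_pochhammer_quotient: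
  fixes c :: complex
  assumes "A > 0" "B > 0" "0 < \<rho>" "\<rho> < 1" and c: "c \<notin> \<int>\<^sub>\<le>\<^sub>0"
  shows "summable (\<lambda>k. real (Suc k) ^ j * (pochhammer A k / norm (pochhammer c k) *
                    (pochhammer B k / fact k * \<rho> ^ k)))" (is "summable ?f")
proof (rule summable_ratio_limit[OF _ _ \<open>\<rho> < 1\<close>])
  have nz: "pochhammer c k \<noteq> 0" for k
    using c by (auto simp: pochhammer_eq_0_iff)
  have cn: "c + of_nat k \<noteq> 0" for k
    using c by (metis add_eq_0_iff2 minus_of_nat_in_nonpos_Ints)
  show "?f k > 0" for k
    using assms nz by (auto intro!: mult_pos_pos divide_pos_pos pochhammer_pos)
  have "?f (Suc k) / ?f k =
      ((2 + real k) / (real k + 1)) ^ j * ((A + k) / (real k + 1)) / norm ((c + of_nat k) / (of_nat k + 1)) *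
      ((B + k) / (real k + 1)) * \<rho>" for k
  proof -
    \<comment> \<open>Field arithmetic on abstract positive reals; the linear factors are divided by
      \<open>z\<close>, which becomes \<open>k + 1\<close>, so that each of them has limit
      1.\<close>
    have ratio: "(s' * (a * e / (n * m) * (b * d / (z * F) * (\<rho> * r)))) / (s * (a / n * (b / F * r))) =
             (s' / s) * (e / z) / (m / z) * (d / z) * \<rho>"
      if "s > 0" "a > 0" "n > 0" "m > 0" "b > 0" "z > 0" "F > 0" "r > 0"
      for s s' a e n m b d z F r :: real
      using that by (simp add: field_simps)
    have *: "norm (of_nat k + 1 :: complex) = real k + 1"
      by (metis norm_of_nat of_nat_Suc add.commute)
    have pos: "pochhammer A k > 0" "pochhammer B k > 0" using assms by (auto intro: pochhammer_pos)
    show ?thesis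
      unfolding pochhammer_Suc norm_mult norm_divide fact_Suc power_Suc *
        of_nat_mult of_nat_Suc add.assoc[symmetric] power_divide
      using ratio[of "(real k + 1) ^ j" "pochhammer A k" "norm (pochhammer c k)"
          "norm (c + of_nat k)" "pochhammer B k" "real k + 1" "fact k" "\<rho> ^ k"
          "(2 + real k) ^ j" "A + real k" "B + real k"] pos assms nz[of k] cn[of k]
      by (simp add: add_ac)
  qed
  moreover have "(\<lambda>k. ((2 + real k) / (real k + 1)) ^ j * ((A + k) / (real k + 1)) /
          norm ((c + of_nat k) / (of_nat k + 1)) * ((B + k) / (real k + 1)) * \<rho>)
        \<longlonglongrightarrow> 1 ^ j * 1 / norm (1::complex) * 1 * \<rho>"
    by (intro tendsto_intros tendsto_linear_ratio) auto
  ultimately show "(\<lambda>k. ?f (Suc k) / ?f k) \<longlonglongrightarrow> \<rho>" by simp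
qed

text \<open>The factor \<open>(\<alpha>, m + n) / (c, m + n)\<close> depends only on
  \<open>k = m + n\<close>, so the terms of one diagonal add up to a coefficient of the pair. The
  majorant makes the family summable in norm, which permits the regrouping.\<close>

lemma appell_F1_sums:
  fixes \<alpha> p q c x y :: complex
  assumes "c \<notin> \<int>\<^sub>\<le>\<^sub>0" "norm x < 1" "norm y < 1"
  shows "(\<lambda>k. pochhammer \<alpha> k / pochhammer c k * fps_nth (binomial_pair_fps p q x y) k) sums
           appell_F1 \<alpha> p q c x y"
proof -
  \<comment> \<open>The \<open>1/2\<close> keeps \<rho> positive when both arguments vanish.\<close>
  define \<rho> where "\<rho> = max (1/2) (max (norm x) (norm y))"
  have \<rho>: "0 < \<rho>" "\<rho> < 1" "norm x \<le> \<rho>" "norm y \<le> \<rho>" using assms by (auto simp: \<rho>_def)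
  define t where "t k i = pochhammer p i / fact i * x ^ i *
                 (pochhammer q (k - i) / fact (k - i) * y ^ (k - i))" for k i
  define w where "w k = pochhammer \<alpha> k / pochhammer c k" for k
  define f where "f = (\<lambda>(k, i). w k * t k i)"
  define P where "P = norm p + norm q + 1"
  have P: "P > 0" by (simp add: P_def add_nonneg_pos)
  have bound: "(\<Sum>i\<le>k. norm (f (k, i))) \<le>
      pochhammer (norm \<alpha> + 1) k / norm (pochhammer c k) * (pochhammer P k / fact k * \<rho> ^ k)" for k
  proof -
    have "(\<Sum>i\<le>k. norm (f (k, i))) = norm (w k) * (\<Sum>i\<le>k. norm (t k i))"
      by (simp add: f_def norm_mult sum_distrib_left)
    also have "\<dots> \<le> pochhammer (norm \<alpha> + 1) k / norm (pochhammer c k) * (pochhammer P k / fact k * \<rho> ^ k)"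
      unfolding w_def norm_divide t_def P_def add.assoc
      using \<rho> by (intro mult_mono divide_right_mono norm_pochhammer_le norm_binomial_pair_coeff_le)
         (auto intro!: sum_nonneg divide_nonneg_nonneg pochhammer_nonneg_weak)
    finally show ?thesis .
  qed
  have "summable (\<lambda>k. pochhammer (norm \<alpha> + 1) k / norm (pochhammer c k) * (pochhammer P k / fact k * \<rho> ^ k))"
    using summable_pochhammer_quotient[of "norm \<alpha> + 1" P \<rho> c 0] \<rho> P assms(1)
    by (simp add: add_nonneg_pos)
  hence "summable (\<lambda>k. \<Sum>i\<le>k. norm (f (k, i)))"
    by (rule summable_comparison_test'[of _ 0]) (use bound in \<open>auto simp: sum_nonneg\<close>)
  hence "(\<lambda>k. \<Sum>i\<le>k. norm (f (k, i))) summable_on UNIV"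
    by (intro norm_summable_imp_summable_on) (simp add: sum_nonneg)
  hence "(\<lambda>z. norm (f z)) summable_on Sigma UNIV (\<lambda>k. {..k})"
    by (intro summable_on_SigmaI[where g = "\<lambda>k. \<Sum>i\<le>k. norm (f (k, i))"])
       (auto intro: has_sum_finite)
  hence f: "f summable_on Sigma UNIV (\<lambda>k. {..k})"
    by (rule abs_summable_summable)
  have S: "(\<Sum>\<^sub>\<infinity>i\<in>{..k}. w k * t k i) = w k * fps_nth (binomial_pair_fps p q x y) k" for k
    by (simp add: nth_binomial_pair_fps t_def sum_distrib_left)
  have "appell_F1 \<alpha> p q c x y = infsum f (Sigma UNIV (\<lambda>k. {..k}))"
    unfolding appell_F1_def
    by (rule infsum_reindex_bij_witness[of _ "\<lambda>(k,i). (i, k - i)" "\<lambda>(m,n). (m + n, m)"])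
       (auto simp: f_def w_def t_def pochhammer_fact mult_ac)
  also have "\<dots> = (\<Sum>\<^sub>\<infinity>k. w k * fps_nth (binomial_pair_fps p q x y) k)"
    unfolding f_def S[symmetric]
    by (rule infsum_Sigma'_banach[symmetric]) (use f in \<open>simp add: f_def\<close>)
  finally have eq: "appell_F1 \<alpha> p q c x y = \<dots>" .
  have "(\<lambda>k. w k * fps_nth (binomial_pair_fps p q x y) k) summable_on UNIV"
    unfolding S[symmetric] by (rule summable_on_Sigma_banach) (use f in \<open>simp add: f_def\<close>)
  thus ?thesis unfolding eq
    by (intro has_sum_imp_sums) (simp add: w_def has_sum_infsum)
qed

section \<open>Summation by parts and index shifts\<close>

lemma norm_poly_of_nat_le:
  fixes R :: "'a :: real_normed_field poly"
  shows "\<exists>C. \<forall>k. norm (poly R (of_nat k)) \<le> C * real (Suc k) ^ degree R"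
proof (intro exI allI)
  fix k
  have "norm (poly R (of_nat k)) \<le> (\<Sum>i\<le>degree R. norm (coeff R i) * real k ^ i)"
    unfolding poly_altdef by (rule order.trans[OF norm_sum]) (simp add: norm_mult norm_power)
  also have "\<dots> \<le> (\<Sum>i\<le>degree R. norm (coeff R i) * real (Suc k) ^ degree R)"
  proof (intro sum_mono mult_left_mono)
    fix i assume "i \<in> {..degree R}"
    have "real k ^ i \<le> real (Suc k) ^ i" by (intro power_mono) auto
    also have "\<dots> \<le> real (Suc k) ^ degree R"
      using \<open>i \<in> _\<close> by (intro power_increasing) auto
    finally show "real k ^ i \<le> real (Suc k) ^ degree R" .
  qed auto
  finally show "norm (poly R (of_nat k)) \<le>
      (\<Sum>i\<le>degree R. norm (coeff R i)) * real (Suc k) ^ degree R"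
    by (simp add: sum_distrib_right)
qed

text \<open>The polynomial factor serves the telescoping argument: its boundary terms are polynomial
  multiples of the summand and must tend to zero.\<close>

lemma summable_poly_binomial_pair:
  fixes \<alpha> c p q x y :: complex
  assumes "c \<notin> \<int>\<^sub>\<le>\<^sub>0" "norm x < 1" "norm y < 1"
  shows "summable (\<lambda>k. poly R (of_nat k) *
           (pochhammer \<alpha> k / pochhammer c k * fps_nth (binomial_pair_fps p q x y) k))"
proof -
  define \<rho> where "\<rho> = max (1/2) (max (norm x) (norm y))"
  have \<rho>: "0 < \<rho>" "\<rho> < 1" "norm x \<le> \<rho>" "norm y \<le> \<rho>" using assms by (auto simp: \<rho>_def)
  define P where "P = norm p + norm q + 1"
  have P: "P > 0" by (simp add: P_def add_nonneg_pos)
  obtain C where C: "\<And>k. norm (poly R (of_nat k)) \<le> C * real (Suc k) ^ degree R"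
    using norm_poly_of_nat_le[of R] by blast
  have "0 \<le> C" using C[of 0] norm_ge_zero[of "poly R 0"] by (simp del: norm_ge_zero)
  have v: "norm (fps_nth (binomial_pair_fps p q x y) k) \<le> pochhammer P k / fact k * \<rho> ^ k" for k
    unfolding nth_binomial_pair_fps P_def add.assoc
    by (rule order.trans[OF norm_sum norm_binomial_pair_coeff_le]) (use \<rho> in auto)
  have bound: "norm (poly R (of_nat k) * (pochhammer \<alpha> k / pochhammer c k * fps_nth (binomial_pair_fps p q x y) k))
      \<le> C * real (Suc k) ^ degree R * (pochhammer (norm \<alpha> + 1) k / norm (pochhammer c k) *
                    (pochhammer P k / fact k * \<rho> ^ k))" for k
    unfolding norm_mult norm_divide using \<open>0 \<le> C\<close> \<rho>(1) P
    by (intro mult_mono[OF C mult_mono[OF divide_right_mono[OF norm_pochhammer_le] v]]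
              mult_nonneg_nonneg divide_nonneg_nonneg norm_ge_zero zero_le_power pochhammer_nonneg_weak)
       simp_all
  have "summable (\<lambda>k. C * (real (Suc k) ^ degree R * (pochhammer (norm \<alpha> + 1) k / norm (pochhammer c k) *
                    (pochhammer P k / fact k * \<rho> ^ k))))"
    using \<rho> P assms(1) by (intro summable_mult summable_pochhammer_quotient) (auto simp: add_nonneg_pos)
  thus ?thesis
    by (rule summable_comparison_test'[where N = 0]) (use bound in \<open>simp only: mult.assoc\<close>)
qed

text \<open>Summation by parts against the coefficient recurrence, the discrete form of integrating a total
  derivative of the Euler integrand; the polynomial \<open>r\<close> is a free multiplier.\<close>

lemma sums_zero_binomial_pair:
  fixes \<alpha> c p q x y :: complex and r :: "complex poly"
  assumes "c \<notin> \<int>\<^sub>\<le>\<^sub>0" "norm x < 1" "norm y < 1"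
  defines "D \<equiv> (\<lambda>k. k * (c + k - 1) * (c + k - 2) * poly r (k - 1)
              - ((x + y) * k + p * x + q * y) * (\<alpha> + k) * (c + k - 1) * poly r k
              + x * y * (k + p + q) * (\<alpha> + k) * (\<alpha> + k + 1) * poly r (k + 1))"
  shows "(\<lambda>k. D (of_nat k) * (pochhammer \<alpha> k / pochhammer c k *
                                fps_nth (binomial_pair_fps p q x y) k)) sums 0"
proof -
  define v where "v = fps_nth (binomial_pair_fps p q x y)"
  define W where "W k = pochhammer \<alpha> k / pochhammer c k" for k
  have cn: "c + of_nat k \<noteq> 0" for k
    using assms(1) by (metis add_eq_0_iff2 minus_of_nat_in_nonpos_Ints)
  have W: "W (Suc k) * (c + of_nat k) = W k * (\<alpha> + of_nat k)" for k
    using cn[of k] by (simp add: W_def pochhammer_Suc)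
  \<comment> \<open>\<open>A\<close> and \<open>G\<close> are the outer terms of \<open>D\<close>.
    The coefficient recurrence rewrites \<open>A (Suc k)\<close> as the subtracted middle term minus
    \<open>H k\<close>, where \<open>H\<close> is \<open>G\<close> delayed by one; the two copies of
    \<open>H k\<close> then cancel.\<close>
  define A where "A k = of_nat k * (c + of_nat k - 1) * (c + of_nat k - 2) *
                          poly r (of_nat k - 1) * (W k * v k)" for k
  define G where "G k = x * y * (of_nat k + p + q) * (\<alpha> + of_nat k) * (\<alpha> + of_nat k + 1) *
                          poly r (of_nat k + 1) * (W k * v k)" for k
  \<comment> \<open>The value 0 at \<open>k = 0\<close> matches the absent \<open>v (k - 1)\<close>;
    since \<open>A 0 = 0\<close> as well, telescoping leaves nothing.\<close>
  define H where "H k = (if k = 0 then 0 else G (k - 1))" for k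
  have to_zero: "(\<lambda>k. poly R (of_nat k) * (W k * v k)) \<longlonglongrightarrow> 0" for R
    unfolding W_def v_def by (intro summable_LIMSEQ_zero summable_poly_binomial_pair assms)
  have "A \<longlonglongrightarrow> 0"
    using to_zero[of "[:0, 1:] * [:c - 1, 1:] * [:c - 2, 1:] * pcompose r [:-1, 1:]"]
    by (simp add: A_def[abs_def] poly_pcompose algebra_simps)
  moreover have "G \<longlonglongrightarrow> 0"
    using to_zero[of "[:x * y:] * [:p + q, 1:] * [:\<alpha>, 1:] * [:\<alpha> + 1, 1:] * pcompose r [:1, 1:]"]
    by (simp add: G_def[abs_def] poly_pcompose algebra_simps)
  hence "H \<longlonglongrightarrow> 0" by (subst filterlim_sequentially_Suc[symmetric]) (simp add: H_def)
  ultimately have "(\<lambda>k. (A k - A (Suc k)) + (H (Suc k) - H k)) sums ((A 0 - 0) + (0 - H 0))"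
    by (intro sums_add telescope_sums telescope_sums')
  moreover have "(A k - A (Suc k)) + (H (Suc k) - H k) = D (of_nat k) * (W k * v k)" for k
  proof -
    define S where "S = W k * (\<alpha> + of_nat k) * (c + of_nat k - 1) * poly r (of_nat k)"
    have "A (Suc k) = (of_nat k + 1) * (c + of_nat k - 1) * poly r (of_nat k) * v (Suc k) *
                        (W (Suc k) * (c + of_nat k))"
      by (simp add: A_def algebra_simps)
    also have "\<dots> = S * ((of_nat k + 1) * v (Suc k))"
      unfolding W by (simp add: S_def algebra_simps)
    also have "\<dots> = S * ((x + y) * of_nat k + p * x + q * y) * v k -
        S * (if k = 0 then 0 else x * y * (of_nat k - 1 + p + q) * v (k - 1))"
      unfolding v_def binomial_pair_fps_recurrence by (simp add: algebra_simps)
    also have "S * (if k = 0 then 0 else x * y * (of_nat k - 1 + p + q) * v (k - 1)) = H k"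
    proof (cases k)
      case (Suc m)
      have "S = (W (Suc m) * (c + of_nat m)) * (\<alpha> + of_nat m + 1) * poly r (of_nat m + 1)"
        by (simp add: S_def Suc algebra_simps)
      thus ?thesis unfolding W by (simp add: H_def G_def Suc algebra_simps)
    qed (simp add: H_def)
    finally have "A (Suc k) = S * ((x + y) * of_nat k + p * x + q * y) * v k - H k" .
    thus ?thesis by (simp add: A_def D_def S_def H_def G_def algebra_simps)
  qed
  ultimately show ?thesis by (simp add: W_def v_def A_def H_def)
qed

text \<open>Clearing \<open>pochhammer c d\<close> turns all weights shifted by at most
  \<open>d\<close> into polynomials in \<open>k\<close> times one common weight, so series can be
  compared through polynomials alone.\<close>

lemma pochhammer_quotient_shift:
  fixes \<alpha> c :: "'a :: field_char_0"
  assumes "j \<le> d" and c: "\<And>n. c \<noteq> - of_nat n"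
  shows "pochhammer c d * (pochhammer \<alpha> (k + j) / pochhammer c (k + j)) =
           pochhammer (\<alpha> + of_nat k) j * pochhammer (c + of_nat (k + j)) (d - j) *
           (pochhammer \<alpha> k / pochhammer (c + of_nat d) k)"
proof -
  have nz: "pochhammer c n \<noteq> 0" for n using c by (auto simp: pochhammer_eq_0_iff)
  have "pochhammer c (k + j) * pochhammer (c + of_nat (k + j)) (d - j) = pochhammer c (k + d)"
    using assms by (metis add.assoc le_add_diff_inverse pochhammer_product')
  also have "\<dots> = pochhammer c d * pochhammer (c + of_nat d) k"
    by (metis add.commute pochhammer_product')
  finally have "pochhammer (c + of_nat (k + j)) (d - j) =
                  pochhammer c d * pochhammer (c + of_nat d) k / pochhammer c (k + j)"
    using nz[of "k + j"] by (simp add: field_simps)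
  moreover have "pochhammer (c + of_nat d) k \<noteq> 0"
    using nz[of "d + k"] by (simp add: pochhammer_product')
  ultimately show ?thesis using nz[of "k + j"] by (simp add: pochhammer_product'[of \<alpha>])
qed

text \<open>Multiplying by \<open>t^j\<close> moves the index of the weights by \<open>j\<close>.
  Convergence holds because \<open>w (k + j)\<close> is \<open>w j\<close> times the weight with
  parameters \<open>\<alpha> + j\<close> and \<open>c + j\<close>.\<close>

lemma shifted_series_binomial_pair:
  fixes \<alpha> c p q x y :: complex
  assumes "c \<notin> \<int>\<^sub>\<le>\<^sub>0" "norm x < 1" "norm y < 1"
  defines "h \<equiv> binomial_pair_fps p q x y" and "w \<equiv> \<lambda>k. pochhammer \<alpha> k / pochhammer c k"
  shows "(\<lambda>k. w k * fps_nth (fps_X ^ j * h) k) sums (\<Sum>k. w (k + j) * fps_nth h k)"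
    and "summable (\<lambda>k. w (k + j) * fps_nth h k)"
proof -
  have "c + of_nat j \<notin> \<int>\<^sub>\<le>\<^sub>0"
    using assms(1) by (metis add_diff_cancel_right' nonpos_Ints_diff_Nats of_nat_in_Nats)
  from summable_mult[OF summable_poly_binomial_pair[OF this assms(2,3), of 1 "\<alpha> + of_nat j" p q],
         of "w j"]
  show *: "summable (\<lambda>k. w (k + j) * fps_nth h k)"
    by (simp add: w_def h_def pochhammer_product' add.commute[of _ j] mult_ac)
  have "(\<lambda>k. w (k + j) * fps_nth (fps_X ^ j * h) (k + j)) sums (\<Sum>k. w (k + j) * fps_nth h k)"
    using summable_sums[OF *] by (simp add: fps_X_power_mult_nth)
  thus "(\<lambda>k. w k * fps_nth (fps_X ^ j * h) k) sums (\<Sum>k. w (k + j) * fps_nth h k)"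
    \<comment> \<open>The first \<open>j\<close> coefficients of \<open>fps_X ^ j * h\<close>
      vanish.\<close>
    by (subst (asm) sums_zero_iff_shift) (simp_all add: fps_X_power_mult_nth)
qed

section \<open>The first-order recurrence\<close>

text \<open>A polynomial factor of the generating function is transferred to the weights, so that
  series with different exponents become series in the same coefficients.\<close>

lemma appell_F1_sums_multiplier:
  fixes \<alpha> c p q p' q' x y :: complex
  assumes "c \<notin> \<int>\<^sub>\<le>\<^sub>0" "norm x < 1" "norm y < 1"
  defines "h \<equiv> binomial_pair_fps p' q' x y"
  assumes eq: "binomial_pair_fps p q x y = (\<Sum>j\<le>n. fps_const (u j) * (fps_X ^ j * h))"
  shows "(\<lambda>k. (\<Sum>j\<le>n. u j * (pochhammer \<alpha> (k + j) / pochhammer c (k + j))) * fps_nth h k) sums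
           appell_F1 \<alpha> p q c x y"
proof -
  define w where "w k = pochhammer \<alpha> k / pochhammer c k" for k
  have shift: "(\<lambda>k. w k * fps_nth (fps_X ^ j * h) k) sums (\<Sum>k. w (k + j) * fps_nth h k)"
    and summable: "summable (\<lambda>k. w (k + j) * fps_nth h k)" for j
    unfolding w_def h_def by (rule shifted_series_binomial_pair[OF assms(1-3)])+
  define S where "S = (\<Sum>j\<le>n. u j * (\<Sum>k. w (k + j) * fps_nth h k))"
  have "(\<lambda>k. \<Sum>j\<le>n. u j * (w k * fps_nth (fps_X ^ j * h) k)) sums S"
    unfolding S_def by (rule sums_sum[OF sums_mult[OF shift]])
  moreover have "(\<Sum>j\<le>n. u j * (w k * fps_nth (fps_X ^ j * h) k)) =
                   w k * fps_nth (binomial_pair_fps p q x y) k" for k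
    by (simp add: eq fps_sum_nth sum_distrib_left mult.left_commute)
  ultimately have "(\<lambda>k. w k * fps_nth (binomial_pair_fps p q x y) k) sums S" by (simp only:)
  moreover have "(\<lambda>k. w k * fps_nth (binomial_pair_fps p q x y) k) sums appell_F1 \<alpha> p q c x y"
    unfolding w_def by (rule appell_F1_sums[OF assms(1-3)])
  ultimately have "appell_F1 \<alpha> p q c x y = S"
    using sums_unique2 by blast
  moreover have "(\<lambda>k. \<Sum>j\<le>n. u j * (w (k + j) * fps_nth h k)) sums S"
    unfolding S_def by (rule sums_sum[OF sums_mult[OF summable_sums[OF summable]]])
  ultimately show ?thesis
    by (simp only: w_def sum_distrib_right mult.assoc)
qed

text \<open>Both sides are series in the coefficients of \<open>h = (1 - x t)^a (1 - y t)^(-3a - 11/2)\<close> with the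
  weights \<open>W\<close>: the generating functions for \<open>a\<close> and \<open>a + 1\<close> are \<open>(1 - y t)^3 h\<close> and \<open>(1 - x t) h\<close>.
  The multiplier \<open>r\<close> was found by solving the linear system \<open>D = P - K Q\<close> for its coefficients.\<close>

lemma appell_F1_recurrence:
  fixes a :: complex
  defines "F \<equiv> \<lambda>a. appell_F1 (1 / 2) (- a) (3 * a + 5 / 2) (4 * a + 9 / 2) (27 / 32) (5 / 6)"
  assumes "4 * a + 9 / 2 \<notin> \<int>\<^sub>\<le>\<^sub>0"
  shows "pochhammer (4 * a + 9 / 2) 4 * F a =
           64 * (a + 3 / 2) ^ 2 * (2 * a + 5 / 2) * (2 * a + 7 / 2) * F (a + 1)"
proof -
  define c x y where "c = 4 * a + 9 / 2" and "x = (27 / 32 :: complex)" and "y = (5 / 6 :: complex)"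
  define h where "h = binomial_pair_fps (- a) (3 * a + 11 / 2) x y"
  define K where "K = 64 * (a + 3 / 2) ^ 2 * (2 * a + 5 / 2) * (2 * a + 7 / 2)"
  \<comment> \<open>The parameter \<open>c + 5\<close> is common to both sides: the series for
    \<open>a\<close> has \<open>c\<close> and is cleared by \<open>pochhammer c 5\<close>, the one
    for \<open>a + 1\<close> has \<open>c + 4\<close> and is cleared by the single factor
    \<open>c + 4\<close>.\<close>
  define W where "W k = pochhammer (1 / 2) k / pochhammer (c + 5) k" for k
  \<comment> \<open>\<open>P\<close> collects the weights produced by \<open>(1 - y t)^3\<close> and
    \<open>Q\<close> those produced by \<open>1 - x t\<close>, both with denominators
    cleared.\<close>
  define P where "P z = pochhammer (c + z) 5
       - 3 * y * (pochhammer (1 / 2 + z) 1 * pochhammer (c + z + 1) 4)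
       + 3 * y ^ 2 * (pochhammer (1 / 2 + z) 2 * pochhammer (c + z + 2) 3)
       - y ^ 3 * (pochhammer (1 / 2 + z) 3 * pochhammer (c + z + 3) 2)" for z
  define Q where "Q z = c + 4 + z - x * (1 / 2 + z)" for z
  define r where "r = [:64 * a ^ 2 + 560 / 3 * a + 134, 64 / 9 * a + 48 / 5, 8 / 45:]"
  \<comment> \<open>The multiplier from \<open>sums_zero_binomial_pair\<close>, for third parameter
    \<open>c + 5\<close> and the exponents of \<open>h\<close>.\<close>
  define D where "D z = z * (c + 5 + z - 1) * (c + 5 + z - 2) * poly r (z - 1)
       - ((x + y) * z + (- a) * x + (3 * a + 11 / 2) * y) * (1 / 2 + z) * (c + 5 + z - 1) * poly r z
       + x * y * (z + (- a) + (3 * a + 11 / 2)) * (1 / 2 + z) * (1 / 2 + z + 1) * poly r (z + 1)" for z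
  have c: "c \<notin> \<int>\<^sub>\<le>\<^sub>0" using assms by (simp add: c_def)
  have c4: "c + of_nat m \<notin> \<int>\<^sub>\<le>\<^sub>0" for m
    using c by (metis add_diff_cancel_right' nonpos_Ints_diff_Nats of_nat_in_Nats)
  have xy: "norm x < 1" "norm y < 1" by (simp_all add: x_def y_def norm_divide)
  have ne: "c \<noteq> - of_nat n" and ne4: "c + 4 \<noteq> - of_nat n" for n using c c4[of 4] by auto
  define X where "X = (fps_X :: complex fps)"
  have step: "neg_binomial_fps q y = (1 - fps_const y * X) * neg_binomial_fps q' y" if "q' = q + 1" for q q'
    unfolding X_def that by (rule neg_binomial_fps_shift[symmetric])
  \<comment> \<open>Three shifts lead from \<open>3 * a + 5 / 2\<close> to
    \<open>3 * a + 11 / 2\<close>, the second parameter belonging to \<open>a + 1\<close>.\<close>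
  have "neg_binomial_fps (3 * a + 5 / 2) y = (1 - fps_const y * X) * ((1 - fps_const y * X) *
          ((1 - fps_const y * X) * neg_binomial_fps (3 * a + 11 / 2) y))"
    using step[of "3 * a + 7 / 2" "3 * a + 5 / 2"] step[of "3 * a + 9 / 2" "3 * a + 7 / 2"]
          step[of "3 * a + 11 / 2" "3 * a + 9 / 2"] by simp
  hence "binomial_pair_fps (- a) (3 * a + 5 / 2) x y = (1 - fps_const y * X) ^ 3 * h"
    by (simp add: h_def binomial_pair_fps_def power3_eq_cube mult_ac)
  also have "\<dots> = h - fps_const (3 * y) * (X * h) + fps_const (3 * y ^ 2) * (X ^ 2 * h)
                  - fps_const (y ^ 3) * (X ^ 3 * h)"
  proof -
    have "fps_const (3 * y) = 3 * fps_const y" "fps_const (3 * y ^ 2) = 3 * fps_const y ^ 2"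
         "fps_const (y ^ 3) = fps_const y ^ 3"
      by (simp_all add: numeral_fps_const)
    thus ?thesis by (simp only:) (simp add: power2_eq_square power3_eq_cube algebra_simps)
  qed
  also have "\<dots> = (\<Sum>j\<le>3. fps_const ([1, - 3 * y, 3 * y ^ 2, - (y ^ 3)] ! j) * (fps_X ^ j * h))"
    by (simp add: numeral_3_eq_3 numeral_2_eq_2 X_def flip: fps_const_neg)
  finally have "(\<lambda>k. (\<Sum>j\<le>3. [1, - 3 * y, 3 * y ^ 2, - (y ^ 3)] ! j *
                   (pochhammer (1 / 2) (k + j) / pochhammer c (k + j))) * fps_nth h k) sums F a"
    unfolding F_def x_def[symmetric] y_def[symmetric] c_def[symmetric]
    unfolding h_def by (rule appell_F1_sums_multiplier[OF c xy])
  from sums_mult[OF this, of "pochhammer c 5"]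
  have Fa: "(\<lambda>k. P (of_nat k) * (W k * fps_nth h k)) sums (pochhammer c 5 * F a)"
  proof (rule sums_cong[THEN iffD1, rotated])
    fix k
    define q where "q j = pochhammer (1 / 2) (k + j) / pochhammer c (k + j)" for j
    have q: "pochhammer c 5 * q j = pochhammer (1 / 2 + of_nat k) j *
                pochhammer (c + of_nat (k + j)) (5 - j) * W k" if "j \<le> 5" for j
      using pochhammer_quotient_shift[OF that ne, of "1 / 2" k] by (simp add: q_def W_def)
    have "pochhammer c 5 * ((\<Sum>j\<le>3. [1, - 3 * y, 3 * y ^ 2, - (y ^ 3)] ! j * q j) * fps_nth h k) =
            (pochhammer c 5 * q 0 - 3 * y * (pochhammer c 5 * q 1) +
             3 * y ^ 2 * (pochhammer c 5 * q 2) - y ^ 3 * (pochhammer c 5 * q 3)) * fps_nth h k"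
      by (simp add: numeral_3_eq_3 numeral_2_eq_2 algebra_simps)
    also have "\<dots> = P (of_nat k) * (W k * fps_nth h k)"
      by (subst q; simp)+ (simp add: P_def algebra_simps)
    finally show "pochhammer c 5 * ((\<Sum>j\<le>3. [1, - 3 * y, 3 * y ^ 2, - (y ^ 3)] ! j *
        (pochhammer (1 / 2) (k + j) / pochhammer c (k + j))) * fps_nth h k) =
        P (of_nat k) * (W k * fps_nth h k)" by (simp add: q_def)
  qed

  have "binomial_pair_fps (- (a + 1)) (3 * (a + 1) + 5 / 2) x y = (1 - fps_const x * X) * h"
  proof -
    have "3 * (a + 1) + 5 / 2 = 3 * a + 11 / 2" by (simp add: field_simps)
    moreover have "neg_binomial_fps (- (a + 1)) x = (1 - fps_const x * X) * neg_binomial_fps (- a) x"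
      using neg_binomial_fps_shift[of x "- a - 1"] by (simp add: X_def)
    ultimately show ?thesis unfolding h_def binomial_pair_fps_def by (simp only: mult.assoc)
  qed
  also have "\<dots> = (\<Sum>j\<le>1. fps_const ([1, - x] ! j) * (fps_X ^ j * h))"
    by (simp add: X_def algebra_simps flip: fps_const_neg)
  finally have "(\<lambda>k. (\<Sum>j\<le>1. [1, - x] ! j *
      (pochhammer (1 / 2) (k + j) / pochhammer (c + 4) (k + j))) * fps_nth h k) sums F (a + 1)"
    using appell_F1_sums_multiplier[OF c4[of 4] xy, where p = "- (a + 1)"
        and q = "3 * (a + 1) + 5 / 2" and p' = "- a" and q' = "3 * a + 11 / 2" and n = 1
        and u = "\<lambda>j. [1, - x] ! j" and \<alpha> = "1 / 2"]
    by (simp add: F_def x_def y_def c_def h_def algebra_simps)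
  from sums_mult[OF this, of "pochhammer (c + 4) 1"]
  have Fa1: "(\<lambda>k. Q (of_nat k) * (W k * fps_nth h k)) sums ((c + 4) * F (a + 1))"
    unfolding pochhammer_1
  proof (rule sums_cong[THEN iffD1, rotated])
    fix k
    define q where "q j = pochhammer (1 / 2) (k + j) / pochhammer (c + 4) (k + j)" for j
    have q: "(c + 4) * q j = pochhammer (1 / 2 + of_nat k) j *
                pochhammer (c + 4 + of_nat (k + j)) (1 - j) * W k" if "j \<le> 1" for j
      using pochhammer_quotient_shift[OF that ne4, of "1 / 2" k]
      by (simp add: q_def W_def add.commute[of 5])
    have "(c + 4) * ((\<Sum>j\<le>1. [1, - x] ! j * q j) * fps_nth h k) =
            ((c + 4) * q 0 - x * ((c + 4) * q 1)) * fps_nth h k"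
      by (simp add: algebra_simps)
    also have "\<dots> = Q (of_nat k) * (W k * fps_nth h k)"
      by (subst q; simp)+ (simp add: Q_def algebra_simps)
    finally show "(c + 4) * ((\<Sum>j\<le>1. [1, - x] ! j *
        (pochhammer (1 / 2) (k + j) / pochhammer (c + 4) (k + j))) * fps_nth h k) =
        Q (of_nat k) * (W k * fps_nth h k)" by (simp add: q_def)
  qed

  have "(\<lambda>k. P (of_nat k) * (W k * fps_nth h k) - K * (Q (of_nat k) * (W k * fps_nth h k))) sums
          (pochhammer c 5 * F a - K * ((c + 4) * F (a + 1)))"
    by (intro sums_diff sums_mult Fa Fa1)
  moreover have "(\<lambda>k. P (of_nat k) * (W k * fps_nth h k) - K * (Q (of_nat k) * (W k * fps_nth h k))) sums 0"
  proof (rule sums_cong[THEN iffD1, rotated])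
    show "(\<lambda>k. D (of_nat k) * (W k * fps_nth h k)) sums 0"
      using sums_zero_binomial_pair[OF c4[of 5] xy, where p = "- a" and q = "3 * a + 11 / 2"
          and \<alpha> = "1 / 2" and r = r]
      by (simp add: D_def W_def h_def)
  next
    fix k
    have poch: "pochhammer z 1 = z" "pochhammer z 2 = z * (z + 1)"
        "pochhammer z 3 = z * (z + 1) * (z + 2)"
        "pochhammer z 4 = z * (z + 1) * (z + 2) * (z + 3)"
        "pochhammer z 5 = z * (z + 1) * (z + 2) * (z + 3) * (z + 4)" for z :: complex
      by (simp_all add: eval_nat_numeral pochhammer_Suc)
    have r: "poly r z = 64 * a ^ 2 + 560 / 3 * a + 134 + (64 / 9 * a + 48 / 5) * z + 8 / 45 * z ^ 2" for z
      by (simp add: r_def power2_eq_square algebra_simps)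
    \<comment> \<open>The certificate itself: at these values of \<open>x\<close>, \<open>y\<close>
      and \<open>c\<close> it is a polynomial identity in \<open>a\<close> and
      \<open>z\<close>.\<close>
    have "D z = P z - K * Q z" for z
      unfolding D_def P_def Q_def K_def r x_def y_def c_def poch by algebra
    thus "D (of_nat k) * (W k * fps_nth h k) =
            P (of_nat k) * (W k * fps_nth h k) - K * (Q (of_nat k) * (W k * fps_nth h k))"
      by (simp only: left_diff_distrib mult.assoc)
  qed
  ultimately have "pochhammer c 5 * F a - K * ((c + 4) * F (a + 1)) = 0"
    by (rule sums_unique2)
  \<comment> \<open>The factor \<open>c + 4\<close> comes from clearing up to \<open>c + 5\<close>
    on both sides; cancelling it leaves the stated relation.\<close>
  moreover have "pochhammer c 5 = pochhammer c 4 * (c + 4)"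
    using pochhammer_Suc[of c 4] by simp
  moreover have "c + 4 \<noteq> 0" using ne[of 4] by (auto simp: add_eq_0_iff2)
  ultimately show ?thesis by (simp add: c_def K_def)
qed

section \<open>The limit along integer shifts\<close>

text \<open>Each of the \<open>m\<close> factors grows like \<open>s * n\<close>. In the terms of
  the series these powers of \<open>n\<close> cancel, numerator and denominator having equal degree
  in the shift.\<close>

lemma tendsto_pochhammer_affine_scaled:
  fixes a s e :: complex
  shows "(\<lambda>n. pochhammer (s * (a + of_nat n) + e) m / of_nat n ^ m) \<longlonglongrightarrow> s ^ m"
proof (induction m)
  case (Suc m)
  have "(\<lambda>n. s + (s * a + e + of_nat m) * inverse (of_nat n)) \<longlonglongrightarrow> s + (s * a + e + of_nat m) * 0"
    by (intro tendsto_intros lim_inverse_n)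
  hence "(\<lambda>n. s + (s * a + e + of_nat m) * inverse (of_nat n)) \<longlonglongrightarrow> s" by simp
  moreover have "eventually (\<lambda>n. s + (s * a + e + of_nat m) * inverse (of_nat n) =
                   (s * (a + of_nat n) + e + of_nat m) / of_nat n) sequentially"
    using eventually_gt_at_top[of 0] by eventually_elim (simp add: field_simps)
  ultimately have "(\<lambda>n. (s * (a + of_nat n) + e + of_nat m) / of_nat n) \<longlonglongrightarrow> s"
    by (rule Lim_transform_eventually)
  from tendsto_mult[OF Suc this] show ?case
    by (simp add: pochhammer_Suc mult_ac)
qed auto

text \<open>Each factor is \<open>1 + d / (t + i)\<close>, which does not increase with
  \<open>t\<close>. This makes a bound whose \<open>t\<close> grows with the shift uniform.\<close>

lemma pochhammer_quotient_mono:
  fixes s t d :: real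
  assumes "0 < s" "s \<le> t" "0 \<le> d"
  shows "pochhammer (t + d) k / pochhammer t k \<le> pochhammer (s + d) k / pochhammer s k"
proof (induction k)
  case (Suc k)
  have "(t + d + real k) / (t + real k) \<le> (s + d + real k) / (s + real k)"
  proof -
    have "d * (s + real k) \<le> d * (t + real k)" using assms by (intro mult_left_mono) auto
    thus ?thesis using assms by (simp add: divide_simps) (simp add: algebra_simps)
  qed
  with Suc have "pochhammer (t + d) k / pochhammer t k * ((t + d + real k) / (t + real k)) \<le>
                   pochhammer (s + d) k / pochhammer s k * ((s + d + real k) / (s + real k))"
    using assms by (intro mult_mono) (auto intro!: divide_nonneg_nonneg pochhammer_nonneg_weak)
  thus ?case by (simp add: pochhammer_Suc)
qed auto

text \<open>Factor by factor, the modulus is at least the real part.\<close>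

lemma pochhammer_le_norm_pochhammer:
  fixes c :: complex
  assumes "0 \<le> s" "s \<le> Re c"
  shows "pochhammer s k \<le> norm (pochhammer c k)"
proof (induction k)
  case (Suc k)
  have "s + real k \<le> norm (c + of_nat k)"
    using assms complex_Re_le_cmod[of "c + of_nat k"] by simp
  thus ?case using Suc assms
    by (auto simp: pochhammer_Suc norm_mult intro!: mult_mono)
qed auto

lemma neg_binomial_powr_series:
  fixes z :: complex
  assumes "norm z < 1"
  shows "(\<lambda>k. pochhammer b k / fact k * z ^ k) sums (1 - z) powr (- b)"
proof -
  have "(\<lambda>k. (- b gchoose k) * (- z) ^ k) sums (1 + - z) powr (- b)"
    by (rule gen_binomial_complex) (use assms in simp)
  moreover have "(- b gchoose k) * (- z) ^ k = pochhammer b k / fact k * z ^ k" for k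
    unfolding gbinomial_pochhammer power_minus[of z] by (simp add: mult_ac)
  ultimately show ?thesis by simp
qed

text \<open>Termwise, \<open>(-a, m) (3a, n) / (4a, m + n)\<close> tends to \<open>(-1/4)^m (3/4)^n\<close>, which leaves the binomial series
  of exponent \<open>-1/2\<close>.\<close>

lemma appell_F1_limit:
  fixes a x y :: complex
  assumes xy: "norm x < 1" "norm y < 1"
  defines "F \<equiv> \<lambda>a. appell_F1 (1 / 2) (- a) (3 * a + 5 / 2) (4 * a + 9 / 2) x y"
  shows "(\<lambda>n. F (a + of_nat n)) \<longlonglongrightarrow> (1 - (3 * y - x) / 4) powr (- 1 / 2)"
proof -
  define w where "w k a = pochhammer (1 / 2) k / pochhammer (4 * a + 9 / 2) k" for k and a :: complex
  define u where "u k a = fps_nth (binomial_pair_fps (- a) (3 * a + 5 / 2) x y) k" for k a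
  define z where "z = (3 * y - x) / 4"
  define \<rho> where "\<rho> = max (1/2) (max (norm x) (norm y))"
  have \<rho>: "0 < \<rho>" "\<rho> < 1" "norm x \<le> \<rho>" "norm y \<le> \<rho>" using xy by (auto simp: \<rho>_def)
  have "norm (3 * y - x) \<le> 3 * norm y + norm x"
    using norm_triangle_ineq4[of "3 * y" x] by (simp add: norm_mult)
  hence z: "norm z < 1" using xy by (simp add: z_def norm_divide)
  \<comment> \<open>The numerator parameters are bounded in total by
    \<open>4 * (norm a + real n) + 5 / 2\<close>, the denominator parameter from below by
    \<open>4 * (real n - norm a) + 5 / 2\<close>; the gap \<open>d\<close> is independent of
    \<open>n\<close>.\<close>
  define d where "d = 8 * norm a"
  define M where "M k = pochhammer (1 + d) k / fact k * \<rho> ^ k" for k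
  define N where "N = nat \<lceil>norm a\<rceil>"
  have N: "norm a \<le> real N" by (simp add: N_def real_nat_ceiling_ge)

  have bound: "norm (w k (a + of_nat n) * u k (a + of_nat n)) \<le> M k" if "n \<ge> N" for k n
  proof -
    let ?b = "a + of_nat n"
    \<comment> \<open>The constant \<open>5 / 2\<close> in place of \<open>9 / 2\<close> makes the
      numerator bound exactly \<open>t + d\<close>.\<close>
    define t where "t = 4 * (real n - norm a) + 5 / 2"
    have n: "norm a \<le> real n" using N that by linarith
    have b: "norm ?b \<le> norm a + real n" using norm_triangle_ineq[of a "of_nat n"] by simp
    have "norm (3 * ?b + 5 / 2) \<le> 3 * norm ?b + 5 / 2"
      using norm_triangle_ineq[of "3 * ?b" "5 / 2"]
      by (simp add: norm_mult del: distrib_left_numeral)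
    also have "\<dots> \<le> 3 * (norm a + real n) + 5 / 2" using b by simp
    finally have "norm (u k ?b) \<le> pochhammer ((norm a + real n) + (3 * (norm a + real n) + 5 / 2)) k / fact k * \<rho> ^ k"
      unfolding u_def nth_binomial_pair_fps
      by (intro order.trans[OF norm_sum norm_binomial_pair_coeff_le] \<rho>(3,4)) (use b in \<open>simp only: norm_minus_cancel\<close>)
    also have "(norm a + real n) + (3 * (norm a + real n) + 5 / 2) = t + d" by (simp add: t_def d_def)
    finally have u: "norm (u k ?b) \<le> pochhammer (t + d) k / fact k * \<rho> ^ k" .
    have "t \<le> Re (4 * ?b + 9 / 2)" using abs_Re_le_cmod[of a] by (simp add: t_def)
    moreover have t: "0 < t" "1 \<le> t" using n by (simp_all add: t_def)
    ultimately have "pochhammer t k \<le> norm (pochhammer (4 * ?b + 9 / 2) k)"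
      by (intro pochhammer_le_norm_pochhammer) auto
    \<comment> \<open>The resulting \<open>fact k\<close> cancels the one in the denominator of the
      coefficient bound.\<close>
    moreover have "norm (pochhammer (1 / 2 :: complex) k) \<le> pochhammer 1 k"
      by (rule norm_pochhammer_le) simp
    moreover have tk: "pochhammer t k > 0" using t by (intro pochhammer_pos) auto
    ultimately have w: "norm (w k ?b) \<le> fact k / pochhammer t k"
      unfolding w_def norm_divide by (intro frac_le) (simp_all flip: pochhammer_fact)
    have "norm (w k ?b * u k ?b) \<le> fact k / pochhammer t k * (pochhammer (t + d) k / fact k * \<rho> ^ k)"
      unfolding norm_mult using w u tk by (intro mult_mono) auto
    also have "\<dots> = pochhammer (t + d) k / pochhammer t k * \<rho> ^ k" by simp
    also have "\<dots> \<le> pochhammer (1 + d) k / pochhammer 1 k * \<rho> ^ k"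
      using t \<rho> by (intro mult_right_mono pochhammer_quotient_mono) (auto simp: d_def)
    finally show ?thesis by (simp add: M_def flip: pochhammer_fact)
  qed

  have "summable M"
    using summable_pochhammer_quotient[of 1 "1 + d" \<rho> 1 0] \<rho>
    by (simp add: M_def[abs_def] d_def add_pos_nonneg flip: pochhammer_fact)

  have limit: "(\<lambda>n. w k (a + of_nat n) * u k (a + of_nat n)) \<longlonglongrightarrow>
                 pochhammer (1 / 2) k / fact k * z ^ k" for k
  proof -
    define P where "P s e m n = pochhammer (s * (a + of_nat n) + e) m / of_nat n ^ m"
      for s e :: complex and m n
    have P: "P s e m \<longlonglongrightarrow> s ^ m" for s e m
      unfolding P_def by (rule tendsto_pochhammer_affine_scaled)
    \<comment> \<open>Every Pochhammer symbol is divided by its power of \<open>n\<close>; for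
      \<open>n > 0\<close> the powers \<open>n^i * n^(k - i)\<close> above and \<open>n^k\<close>
      below cancel.\<close>
    define T where "T n = pochhammer (1 / 2) k / P 4 (9 / 2) k n * (\<Sum>i\<le>k. P (- 1) 0 i n / fact i * x ^ i *
              (P 3 (5 / 2) (k - i) n / fact (k - i) * y ^ (k - i)))" for n
    have T: "T \<longlonglongrightarrow> pochhammer (1 / 2) k / 4 ^ k * (\<Sum>i\<le>k. (- 1) ^ i / fact i * x ^ i *
              (3 ^ (k - i) / fact (k - i) * y ^ (k - i)))"
      unfolding T_def by (intro tendsto_intros P) auto
    \<comment> \<open>The binomial theorem recombines the limits of the factors; division by
      \<open>4 ^ k\<close> then makes \<open>z\<close> the base.\<close>
    have "(\<Sum>i\<le>k. (- 1) ^ i / fact i * x ^ i * (3 ^ (k - i) / fact (k - i) * y ^ (k - i))) =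
                 (\<Sum>i\<le>k. of_nat (k choose i) * (- x) ^ i * (3 * y) ^ (k - i)) / fact k"
      unfolding sum_divide_distrib
    proof (intro sum.cong refl)
      fix i assume "i \<in> {..k}"
      hence "of_nat (k choose i) = (fact k / (fact i * fact (k - i)) :: complex)"
        by (intro binomial_fact) simp
      thus "(- 1) ^ i / fact i * x ^ i * (3 ^ (k - i) / fact (k - i) * y ^ (k - i)) =
              of_nat (k choose i) * (- x) ^ i * (3 * y) ^ (k - i) / fact k"
        by (simp add: power_mult_distrib power_minus[of x])
    qed
    also have "\<dots> = (3 * y - x) ^ k / fact k"
      by (subst binomial_ring[symmetric]) simp
    finally have *: "T \<longlonglongrightarrow> pochhammer (1 / 2) k / fact k * z ^ k"
      using T by (simp add: z_def power_divide mult_ac)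
    show ?thesis
    proof (rule Lim_transform_eventually[OF * eventually_mono[OF eventually_gt_at_top[of 0]]])
      fix n :: nat assume "0 < n"
      hence n: "(of_nat n :: complex) \<noteq> 0" by simp
      have "(\<Sum>i\<le>k. P (- 1) 0 i n / fact i * x ^ i * (P 3 (5 / 2) (k - i) n / fact (k - i) * y ^ (k - i))) =
              u k (a + of_nat n) / of_nat n ^ k"
        unfolding u_def nth_binomial_pair_fps sum_divide_distrib P_def
      proof (intro sum.cong refl)
        fix i assume "i \<in> {..k}"
        hence "of_nat n ^ k = (of_nat n ^ i * of_nat n ^ (k - i) :: complex)"
          by (simp flip: power_add)
        thus "pochhammer (- 1 * (a + of_nat n) + 0) i / of_nat n ^ i / fact i * x ^ i *
              (pochhammer (3 * (a + of_nat n) + 5 / 2) (k - i) / of_nat n ^ (k - i) / fact (k - i) * y ^ (k - i)) =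
              pochhammer (- (a + of_nat n)) i / fact i * x ^ i *
              (pochhammer (3 * (a + of_nat n) + 5 / 2) (k - i) / fact (k - i) * y ^ (k - i)) / of_nat n ^ k"
          by (simp add: mult_ac)
      qed
      thus "T n = w k (a + of_nat n) * u k (a + of_nat n)"
        using n by (simp only: T_def) (simp add: w_def P_def)
    qed
  qed

  have "(\<lambda>n. \<Sum>k. w k (a + of_nat n) * u k (a + of_nat n)) \<longlonglongrightarrow>
          (\<Sum>k. pochhammer (1 / 2) k / fact k * z ^ k)"
  proof (rule tannerys_theorem[THEN conjunct2, THEN conjunct2, OF limit _ \<open>summable M\<close>])
    show "eventually (\<lambda>(k, n). norm (w k (a + of_nat n) * u k (a + of_nat n)) \<le> M k)
            (at_top \<times>\<^sub>F sequentially)"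
      unfolding eventually_prod_sequentially using bound by auto
  qed simp
  moreover have "(\<Sum>k. pochhammer (1 / 2) k / fact k * z ^ k) = (1 - z) powr (- 1 / 2)"
    using neg_binomial_powr_series[OF z, of "1 / 2"] by (simp add: sums_iff)
  ultimately have L: "(\<lambda>n. \<Sum>k. w k (a + of_nat n) * u k (a + of_nat n)) \<longlonglongrightarrow> (1 - z) powr (- 1 / 2)"
    by (simp only:)
  \<comment> \<open>From \<open>N\<close> on the third parameter has positive real part, so the
    single series represents \<open>F\<close>.\<close>
  have "(\<Sum>k. w k (a + of_nat n) * u k (a + of_nat n)) = F (a + of_nat n)" if "n \<ge> N" for n
  proof -
    have "norm a \<le> real n" using N that by linarith
    hence "0 < Re (4 * (a + of_nat n) + 9 / 2)" using abs_Re_le_cmod[of a] by simp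
    hence "4 * (a + of_nat n) + 9 / 2 \<noteq> - of_nat m" for m
      by (auto dest!: arg_cong[where f = Re])
    hence "4 * (a + of_nat n) + 9 / 2 \<notin> \<int>\<^sub>\<le>\<^sub>0" by (metis nonpos_Ints_cases')
    from appell_F1_sums[OF this xy, of "1 / 2" "- (a + of_nat n)" "3 * (a + of_nat n) + 5 / 2"]
    show ?thesis by (simp add: F_def w_def u_def sums_iff)
  qed
  hence "eventually (\<lambda>n. (\<Sum>k. w k (a + of_nat n) * u k (a + of_nat n)) = F (a + of_nat n)) sequentially"
    by (auto simp: eventually_at_top_linorder)
  from Lim_transform_eventually[OF L this] show ?thesis by (simp add: z_def)
qed

section \<open>Evaluation by Gamma values\<close>

text \<open>At the poles of either \<open>Gamma\<close> factor both sides vanish; elsewhere this is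
  the reciprocal of the duplication formula for \<open>Gamma\<close>.\<close>

lemma rGamma_legendre_duplication:
  fixes z :: complex
  shows "rGamma z * rGamma (z + 1 / 2) * of_real (sqrt pi) = 2 powr (2 * z - 1) * rGamma (2 * z)"
proof (cases "z \<in> \<int>\<^sub>\<le>\<^sub>0 \<or> z + 1 / 2 \<in> \<int>\<^sub>\<le>\<^sub>0")
  case True
  have "2 * z \<in> \<int>\<^sub>\<le>\<^sub>0"
    using True
  proof
    assume "z \<in> \<int>\<^sub>\<le>\<^sub>0"
    then obtain n where "z = - of_nat n" by (elim nonpos_Ints_cases')
    hence "2 * z = - of_nat (2 * n)" by simp
    thus ?thesis by (simp only: minus_of_nat_in_nonpos_Ints)
  next
    assume "z + 1 / 2 \<in> \<int>\<^sub>\<le>\<^sub>0"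
    then obtain n where "z + 1 / 2 = - of_nat n" by (elim nonpos_Ints_cases')
    hence "z = - of_nat n - 1 / 2" by (simp add: eq_diff_eq)
    hence "2 * z = - of_nat (2 * n + 1)" by simp
    thus ?thesis by (simp only: minus_of_nat_in_nonpos_Ints)
  qed
  hence "rGamma (2 * z) = 0" "rGamma z = 0 \<or> rGamma (z + 1 / 2) = 0"
    using True by (simp_all add: rGamma_eq_zero_iff)
  thus ?thesis by auto
next
  case False
  have Ln2: "Ln 2 = of_real (ln 2)" using Ln_of_real[of 2] by simp
  \<comment> \<open>A pole of \<open>Gamma\<close> at \<open>2 * z\<close> would force one at
    \<open>z\<close> or at \<open>z + 1 / 2\<close>, according to the parity of
    \<open>n\<close>.\<close>
  have "2 * z \<notin> \<int>\<^sub>\<le>\<^sub>0"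
  proof
    assume "2 * z \<in> \<int>\<^sub>\<le>\<^sub>0"
    then obtain n where n: "2 * z = - of_nat n" by (elim nonpos_Ints_cases')
    show False
    proof (cases "even n")
      case True
      then obtain m where "n = 2 * m" by (elim evenE)
      hence "z = - of_nat m" using n by simp
      thus False using False by simp
    next
      case odd: False
      then obtain m where "n = 2 * m + 1" by (elim oddE)
      hence "2 * (z + 1 / 2) = 2 * (- of_nat m)" using n by simp
      hence "z + 1 / 2 = - of_nat m" by (metis mult_cancel_left zero_neq_numeral)
      thus False using False by simp
    qed
  qed
  hence nz: "Gamma z \<noteq> 0" "Gamma (z + 1 / 2) \<noteq> 0" "Gamma (2 * z) \<noteq> 0"
    using False by (auto simp: Gamma_eq_zero_iff)
  have "Gamma z * Gamma (z + 1 / 2) = exp ((1 - 2 * z) * of_real (ln 2)) * of_real (sqrt pi) * Gamma (2 * z)"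
    using False by (intro Gamma_legendre_duplication) auto
  also have "exp ((1 - 2 * z) * of_real (ln 2)) = 1 / 2 powr (2 * z - 1)"
    by (simp add: powr_def Ln2 algebra_simps flip: exp_minus' divide_inverse)
  finally show ?thesis using nz by (simp add: rGamma_inverse_Gamma field_simps)
qed

text \<open>Euler's limit: the symbol with \<open>n + 1\<close> factors is a sequence tending to
  \<open>rGamma z\<close>, times an explicit growth factor.\<close>

lemma pochhammer_eq_rGamma_series:
  fixes z :: "'a :: Gamma"
  shows "pochhammer z (Suc n) = rGamma_series z n * (fact n * exp (z * of_real (ln (of_nat n))))"
  by (simp add: rGamma_series_def)

text \<open>The recurrence is iterated in cross-multiplied form and Euler's limit is applied to both
  Pochhammer products. Their growth factors agree since
  \<open>9/8 + 11/8 + 13/8 + 15/8 = 2 * 3/2 + 5/4 + 7/4 = 6\<close>.\<close>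

lemma appell_F1_eq_rGamma_quotient:
  fixes a :: complex
  assumes "4 * a + 9 / 2 \<notin> \<int>\<^sub>\<le>\<^sub>0"
  shows "rGamma (a + 9 / 8) * rGamma (a + 11 / 8) * rGamma (a + 13 / 8) * rGamma (a + 15 / 8) *
           appell_F1 (1 / 2) (- a) (3 * a + 5 / 2) (4 * a + 9 / 2) (27 / 32) (5 / 6) =
         rGamma (a + 3 / 2) ^ 2 * rGamma (a + 5 / 4) * rGamma (a + 7 / 4) * (75 / 128) powr (- 1 / 2)"
proof -
  define F where "F a = appell_F1 (1 / 2) (- a) (3 * a + 5 / 2) (4 * a + 9 / 2) (27 / 32) (5 / 6)" for a
  define A where "A n = pochhammer (a + 9 / 8) n * pochhammer (a + 11 / 8) n *
                        pochhammer (a + 13 / 8) n * pochhammer (a + 15 / 8) n" for n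
  define B where "B n = pochhammer (a + 3 / 2) n ^ 2 * pochhammer (a + 5 / 4) n * pochhammer (a + 7 / 4) n" for n
  have step: "(b + 9 / 8) * (b + 11 / 8) * (b + 13 / 8) * (b + 15 / 8) * F b =
                (b + 3 / 2) ^ 2 * (b + 5 / 4) * (b + 7 / 4) * F (b + 1)"
    if "4 * b + 9 / 2 \<notin> \<int>\<^sub>\<le>\<^sub>0" for b
  proof -
    \<comment> \<open>The consecutive factors \<open>4 * b + 9 / 2 + i\<close> are
      \<open>4 * (b + 9 / 8 + i / 4)\<close>.\<close>
    have A: "pochhammer (4 * b + 9 / 2) 4 =
            256 * ((b + 9 / 8) * (b + 11 / 8) * (b + 13 / 8) * (b + 15 / 8))"
      by (simp add: eval_nat_numeral pochhammer_Suc) algebra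
    have B: "64 * (b + 3 / 2) ^ 2 * (2 * b + 5 / 2) * (2 * b + 7 / 2) =
                     256 * ((b + 3 / 2) ^ 2 * (b + 5 / 4) * (b + 7 / 4))"
      by algebra
    have "256 * ((b + 9 / 8) * (b + 11 / 8) * (b + 13 / 8) * (b + 15 / 8) * F b) =
            256 * ((b + 3 / 2) ^ 2 * (b + 5 / 4) * (b + 7 / 4) * F (b + 1))"
      using appell_F1_recurrence[OF that] unfolding A B F_def by (simp only: mult.assoc)
    thus ?thesis by (simp only: mult_cancel_left) simp
  qed
  have AB: "A n * F a = B n * F (a + of_nat n)" for n
  proof (induction n)
    case (Suc n)
    \<comment> \<open>Raising \<open>a\<close> by \<open>n\<close> raises the third parameter by
      \<open>4 * n\<close>, so the hypothesis is inherited.\<close>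
    have "4 * a + 9 / 2 + of_nat (4 * n) \<notin> \<int>\<^sub>\<le>\<^sub>0"
      using assms by (metis add_diff_cancel_right' nonpos_Ints_diff_Nats of_nat_in_Nats)
    hence b: "4 * (a + of_nat n) + 9 / 2 \<notin> \<int>\<^sub>\<le>\<^sub>0" by (simp add: algebra_simps)
    define q where "q = (a + of_nat n + 9 / 8) * (a + of_nat n + 11 / 8) *
                          (a + of_nat n + 13 / 8) * (a + of_nat n + 15 / 8)"
    have "A (Suc n) * F a = (A n * F a) * q" by (simp add: A_def q_def pochhammer_Suc add_ac mult_ac)
    also have "\<dots> = B n * (q * F (a + of_nat n))" unfolding Suc.IH by (simp add: mult_ac)
    also have "\<dots> = B (Suc n) * F (a + of_nat (Suc n))"
      unfolding q_def step[OF b] by (simp add: B_def pochhammer_Suc power_mult_distrib add_ac mult_ac)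
    finally show ?case .
  qed (simp add: A_def B_def)

  define S where "S n = rGamma_series (a + 9 / 8) n * rGamma_series (a + 11 / 8) n *
      rGamma_series (a + 13 / 8) n * rGamma_series (a + 15 / 8) n" for n
  define T where "T n = rGamma_series (a + 3 / 2) n ^ 2 * rGamma_series (a + 5 / 4) n *
      rGamma_series (a + 7 / 4) n" for n
  have ST: "S n * F a = T n * F (a + of_nat (Suc n))" for n
  proof -
    define l where "l = complex_of_real (ln (real n))"
    define e where "e = fact n ^ 4 * exp ((4 * a + 6) * l)"
    have "exp ((a + 9 / 8) * l) * exp ((a + 11 / 8) * l) * exp ((a + 13 / 8) * l) * exp ((a + 15 / 8) * l) =
            exp ((4 * a + 6) * l)"
      unfolding exp_add[symmetric] by (rule arg_cong[where f = exp]) algebra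
    moreover have "exp ((a + 3 / 2) * l) ^ 2 * exp ((a + 5 / 4) * l) * exp ((a + 7 / 4) * l) = exp ((4 * a + 6) * l)"
      unfolding exp_add[symmetric] power2_eq_square by (rule arg_cong[where f = exp]) algebra
    ultimately have "A (Suc n) = S n * e" "B (Suc n) = T n * e"
      unfolding A_def B_def S_def T_def e_def pochhammer_eq_rGamma_series of_nat_id l_def[symmetric]
      by (auto simp: power_mult_distrib power2_eq_square power4_eq_xxxx mult_ac dest!: sym)
    moreover have "e \<noteq> 0" by (simp add: e_def)
    ultimately show ?thesis using AB[of "Suc n"] by simp
  qed
  \<comment> \<open>Here \<open>(3 * 5/6 - 27/32) / 4 = 53/128\<close>, and
    \<open>1 - 53/128 = 75/128\<close>.\<close>
  have "(\<lambda>n. F (a + of_nat n)) \<longlonglongrightarrow> (75 / 128) powr (- 1 / 2)"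
    using appell_F1_limit[of "27 / 32" "5 / 6" a] by (simp add: F_def norm_divide)
  hence T: "(\<lambda>n. T n * F (a + of_nat (Suc n))) \<longlonglongrightarrow>
          rGamma (a + 3 / 2) ^ 2 * rGamma (a + 5 / 4) * rGamma (a + 7 / 4) * (75 / 128) powr (- 1 / 2)"
    unfolding T_def by (intro tendsto_intros LIMSEQ_Suc)
  have S: "(\<lambda>n. S n * F a) \<longlonglongrightarrow>
      rGamma (a + 9 / 8) * rGamma (a + 11 / 8) * rGamma (a + 13 / 8) * rGamma (a + 15 / 8) * F a"
    unfolding S_def by (intro tendsto_intros)
  show ?thesis
    using LIMSEQ_unique[OF S[unfolded ST] T] unfolding F_def .
qed

theorem mainTheorem8:
  fixes a :: complex
  assumes "4 * a + 9 / 2 \<notin> \<int>\<^sub>\<le>\<^sub>0"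
  shows "appell_F1 (1 / 2) (- a) (3 * a + 5 / 2) (4 * a + 9 / 2) (27 / 32) (5 / 6) =
           1 / (5 * complex_of_real (sqrt 3) * 2 powr (6 * a + 3 / 2)) *
           (complex_of_real pi * Gamma (4 * a + 9 / 2) *
             (rGamma (a + 3 / 2))\<^sup>2 * rGamma (2 * a + 5 / 2))"
proof -
  define F where "F = appell_F1 (1 / 2) (- a) (3 * a + 5 / 2) (4 * a + 9 / 2) (27 / 32) (5 / 6)"
  define s where "s = complex_of_real (sqrt pi)"
  define G where "G = rGamma (4 * a + 9 / 2)"
  define R where "R = rGamma (a + 3 / 2) ^ 2"
  define p where "p = (2 powr (6 * a + 3 / 2) :: complex)"
  define q where "q = (2 powr (2 * a + 3 / 2) :: complex)"
  define h where "h = (2 powr (7 / 2) :: complex)"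
  have nz: "s \<noteq> 0" "G \<noteq> 0" "p \<noteq> 0" "q \<noteq> 0" "h \<noteq> 0"
    using assms by (auto simp: s_def G_def p_def q_def h_def rGamma_eq_zero_iff)
  have s2: "s ^ 2 = of_real pi" by (simp add: s_def flip: of_real_power)

  note dup = rGamma_legendre_duplication[folded s_def]
  \<comment> \<open>\<open>d1\<close> treats the two quarter-shifted factors. \<open>d2\<close> to
    \<open>d4\<close> collapse the four eighth-shifted ones to
    \<open>rGamma (4 * a + 9 / 2)\<close>.\<close>
  have d1: "rGamma (a + 5 / 4) * rGamma (a + 7 / 4) * s = q * rGamma (2 * a + 5 / 2)"
    using dup[of "a + 5 / 4"] by (simp add: q_def algebra_simps)
  have d2: "rGamma (a + 9 / 8) * rGamma (a + 13 / 8) * s = 2 powr (2 * a + 5 / 4) * rGamma (2 * a + 9 / 4)"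
    using dup[of "a + 9 / 8"] by (simp add: algebra_simps)
  have d3: "rGamma (a + 11 / 8) * rGamma (a + 15 / 8) * s = 2 powr (2 * a + 7 / 4) * rGamma (2 * a + 11 / 4)"
    using dup[of "a + 11 / 8"] by (simp add: algebra_simps)
  have d4: "rGamma (2 * a + 9 / 4) * rGamma (2 * a + 11 / 4) * s = 2 powr (4 * a + 7 / 2) * G"
    using dup[of "2 * a + 9 / 4"] by (simp add: G_def algebra_simps)
  \<comment> \<open>Both exponents total \<open>8 * a + 13 / 2\<close>. In this splitting
    \<open>q\<close> cancels against \<open>d1\<close>, and \<open>h\<close> against the numerator
    \<open>sqrt 128\<close> of the limit.\<close>
  have pq: "2 powr (2 * a + 5 / 4) * 2 powr (2 * a + 7 / 4) * 2 powr (4 * a + 7 / 2) = p * q * h"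
    unfolding p_def q_def h_def powr_add[symmetric] by (rule arg_cong[where f = "\<lambda>z. 2 powr z"]) algebra

  have "(75 / 128 :: complex) powr (- 1 / 2) = of_real ((75 / 128) powr (- 1 / 2))"
    using powr_of_real[of "75 / 128" "- 1 / 2"] by simp
  also have "(75 / 128 :: real) powr (- 1 / 2) = sqrt 128 / sqrt 75"
    by (simp add: powr_minus_divide powr_half_sqrt real_sqrt_divide)
  also have "sqrt 128 = 2 powr (7 / 2)"
    using powr_powr[of "2::real" 7 "1 / 2"] by (simp add: powr_half_sqrt)
  also have "sqrt 75 = 5 * sqrt 3"
    using real_sqrt_mult[of 25 3] by simp
  finally have L: "(75 / 128 :: complex) powr (- 1 / 2) = h / (5 * of_real (sqrt 3))"
    using powr_of_real[of 2 "7 / 2"] by (simp add: h_def)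

  \<comment> \<open>\<open>d2\<close>, \<open>d3\<close> and \<open>d4\<close> contribute
    \<open>s ^ 3\<close>; \<open>d1\<close> absorbs one factor, and the remaining
    \<open>s ^ 2\<close> is the \<pi> of the result. Dividing by \<open>G\<close>, nonzero by
    hypothesis, produces \<open>Gamma (4 * a + 9 / 2)\<close>.\<close>
  have "p * q * h * G = 2 powr (2 * a + 5 / 4) * 2 powr (2 * a + 7 / 4) * (2 powr (4 * a + 7 / 2) * G)"
    unfolding pq[symmetric] by (simp only: mult.assoc)
  hence "(p * q * h * G) * F =
          ((2 powr (2 * a + 5 / 4) * rGamma (2 * a + 9 / 4)) * (2 powr (2 * a + 7 / 4) * rGamma (2 * a + 11 / 4))) * s * F"
    unfolding d4[symmetric] by (simp only: mult_ac)
  also have "\<dots> = s ^ 3 * (rGamma (a + 9 / 8) * rGamma (a + 11 / 8) * rGamma (a + 13 / 8) * rGamma (a + 15 / 8) * F)"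
    unfolding d2[symmetric] d3[symmetric] by (simp add: power3_eq_cube mult_ac)
  also have "\<dots> = s ^ 2 * R * (rGamma (a + 5 / 4) * rGamma (a + 7 / 4) * s) * (75 / 128) powr (- 1 / 2)"
    unfolding F_def appell_F1_eq_rGamma_quotient[OF assms]
    by (simp add: R_def power3_eq_cube power2_eq_square mult_ac)
  also have "\<dots> = of_real pi * R * (q * rGamma (2 * a + 5 / 2)) * (h / (5 * of_real (sqrt 3)))"
    unfolding d1 s2 L ..
  finally have "F = of_real pi * R * rGamma (2 * a + 5 / 2) / (5 * of_real (sqrt 3) * p * G)"
    using nz by (simp add: field_simps)
  thus ?thesis by (simp add: F_def R_def p_def G_def Gamma_def field_simps)
qed

end
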